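(* There is an absolute constant $c>0$ such that for all integers $n\geq 1$ $$r_4(\mathbb{Z}_{11}^n) \geq c\, \frac{7^n}{n^3}. $$
   Context: $\mathbb{Z}_m^n$ denotes the additive group $(\mathbb{Z}/m\mathbb{Z})^n$. A proper arithmetic progression of length $k$ in $\mathbb{Z}_m^n$ is a sequence $x, x+d, \ldots, x+(k-1)d$ (with $x,d\in\mathbb{Z}_m^n$) whose $k$ elements are pairwise distinct. $r_k(\mathbb{Z}_m^n)$ denotes the maximal size of a set $S\subseteq\mathbb{Z}_m^n$ that does not contain a proper arithmetic progression of length $k$. *)

theory Defs
  imports Complex_Main "HOL-Algebra.Product_Groups" "HOL-Algebra.Elementary_Groups"
begin

text \<open>
  The group \<open>(\<int>/m\<int>)\<^sup>n\<close>, written multiplicatively as always in HOL-Algebra.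
  For \<open>m > 0\<close> its elements are the functions from \<open>{..<n}\<close> to \<open>{0..<int m}\<close>,
  made \<open>undefined\<close> outside \<open>{..<n}\<close>.
\<close>
definition Zmod_pow :: "nat \<Rightarrow> nat \<Rightarrow> (nat \<Rightarrow> int) monoid" where
  "Zmod_pow m n = product_group {..<n} (\<lambda>_. integer_mod_group m)"

definition arith_prog :: "('a, 'b) monoid_scheme \<Rightarrow> 'a \<Rightarrow> 'a \<Rightarrow> nat \<Rightarrow> 'a" where
  "arith_prog G x d j = x \<otimes>\<^bsub>G\<^esub> (d [^]\<^bsub>G\<^esub> j)"

definition has_proper_AP :: "('a, 'b) monoid_scheme \<Rightarrow> nat \<Rightarrow> 'a set \<Rightarrow> bool" where
  "has_proper_AP G k S \<longleftrightarrow>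
     (\<exists>x\<in>carrier G. \<exists>d\<in>carrier G.
        inj_on (arith_prog G x d) {..<k} \<and> arith_prog G x d ` {..<k} \<subseteq> S)"

text \<open>
  Intended for finite \<open>G\<close> and \<open>k > 0\<close>: the set below is then finite, and it contains
  \<open>card {} = 0\<close>.
\<close>
definition r_AP :: "nat \<Rightarrow> ('a, 'b) monoid_scheme \<Rightarrow> nat" where
  "r_AP k G = Max {card S | S. S \<subseteq> carrier G \<and> \<not> has_proper_AP G k S}"

end

(*
  Take words over the seven digits 0, 1, 2, 3, 4, 5, 8 and group the digits into the classes
  {0,5}, {1,4}, {2,3}, {8}, the orbits of the reflection x |-> 5 - x. Fixing how often each class
  occurs leaves at least 7^n / (n+1)^3 words for some choice of the three free counts. A linear
  programming certificate (digit_weight) assigns to the four positions of a progression weights of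
  the classes that cancel in total when the four words have equal counts, but that are positive
  on every nonconstant 4-progression of digits modulo 11. So every coordinate of a 4-progression
  of such words is constant.
*)
theory Submission
  imports Defs
begin

lemma pow_product_group:
  fixes k :: nat
  shows "d [^]\<^bsub>product_group I G\<^esub> k = (\<lambda>i\<in>I. d i [^]\<^bsub>G i\<^esub> k)"
  by (induction k) (auto intro: restrict_ext)

lemma carrier_Zmod_pow:
  assumes "m > 0"
  shows "carrier (Zmod_pow m n) = ({..<n} \<rightarrow>\<^sub>E {0..<int m})"
  using assms by (simp add: Zmod_pow_def carrier_integer_mod_group)

lemma arith_prog_Zmod_pow:
  assumes "i < n"
  shows "arith_prog (Zmod_pow m n) x d j i = (x i + int j * d i) mod int m"
  using assms by (simp add: arith_prog_def Zmod_pow_def pow_product_group mod_add_right_eq)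

lemma card_le_r_AP:
  assumes "finite (carrier G)" "S \<subseteq> carrier G" "\<not> has_proper_AP G k S"
  shows "card S \<le> r_AP k G"
proof -
  have "{card S | S. S \<subseteq> carrier G \<and> \<not> has_proper_AP G k S} \<subseteq> card ` Pow (carrier G)"
    by auto
  then have "finite {card S | S. S \<subseteq> carrier G \<and> \<not> has_proper_AP G k S}"
    using assms(1) by (meson finite_Pow_iff finite_imageI finite_subset)
  then show ?thesis
    unfolding r_AP_def using assms(2,3) by (intro Max_ge) auto
qed

definition digits :: "int set" where
  "digits = {0, 1, 2, 3, 4, 5, 8}"

text \<open>The coefficients of each class over the four positions sum to zero: 0-3-2+5 for {0,5},
  0-2-1+3 for {1,4}, -1-2+0+3 for {2,3}. The class {8} is normalised to 0 in every position, so its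
  count never enters.\<close>

definition digit_weight :: "int \<Rightarrow> int \<Rightarrow> int \<Rightarrow> int \<Rightarrow> int" where
  "digit_weight p q r s =
     - of_bool (p \<in> {2, 3})
     - (3 * of_bool (q \<in> {0, 5}) + 2 * of_bool (q \<in> {1, 4}) + 2 * of_bool (q \<in> {2, 3}))
     - (2 * of_bool (r \<in> {0, 5}) + of_bool (r \<in> {1, 4}))
     + (5 * of_bool (s \<in> {0, 5}) + 3 * of_bool (s \<in> {1, 4}) + 3 * of_bool (s \<in> {2, 3}))"

lemma digit_weight_const: "digit_weight p p p p = 0"
  by (simp add: digit_weight_def)

lemma digit_weight_pos:
  assumes "x \<in> {0..<11}" "d \<in> {0..<11}" "d \<noteq> 0"
    and "\<And>j::nat. j < 4 \<Longrightarrow> (x + int j * d) mod 11 \<in> digits"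
  shows "digit_weight (x mod 11) ((x + d) mod 11) ((x + 2 * d) mod 11) ((x + 3 * d) mod 11) > 0"
proof -
  \<comment> \<open>Ranging over explicit lists makes the claim executable: it is decided by
    evaluating all 110 pairs of start and difference.\<close>
  have *: "\<forall>x\<in>set [0..10]. \<forall>d\<in>set [1..10].
      x mod 11 \<in> digits \<and> (x + d) mod 11 \<in> digits \<and>
      (x + 2 * d) mod 11 \<in> digits \<and> (x + 3 * d) mod 11 \<in> digits \<longrightarrow>
      digit_weight (x mod 11) ((x + d) mod 11) ((x + 2 * d) mod 11) ((x + 3 * d) mod 11) > 0"
    by code_simp
  have "x mod 11 \<in> digits" "(x + d) mod 11 \<in> digits"
    "(x + 2 * d) mod 11 \<in> digits" "(x + 3 * d) mod 11 \<in> digits"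
    using assms(4)[of 0] assms(4)[of 1] assms(4)[of 2] assms(4)[of 3] by simp_all
  then show ?thesis
    using * assms(1-3) by auto
qed

definition occurrences :: "nat \<Rightarrow> int set \<Rightarrow> (nat \<Rightarrow> int) \<Rightarrow> nat" where
  "occurrences n A w = card ({..<n} \<inter> {i. w i \<in> A})"

text \<open>For words over \<open>digits\<close> these counts determine that of 8; leaving it out
  keeps the pigeonhole loss at (n+1)^3.\<close>

definition word_type :: "nat \<Rightarrow> (nat \<Rightarrow> int) \<Rightarrow> nat \<times> nat \<times> nat" where
  "word_type n w = (occurrences n {0, 5} w, occurrences n {1, 4} w, occurrences n {2, 3} w)"

lemma sum_digit_weight_eq_0:
  assumes "word_type n p = t" "word_type n q = t" "word_type n r = t" "word_type n s = t"
  shows "(\<Sum>i<n. digit_weight (p i) (q i) (r i) (s i)) = 0"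
proof -
  have occ: "(\<Sum>i<n. of_bool (w i \<in> A)) = int (occurrences n A w)" for A and w :: "nat \<Rightarrow> int"
    by (simp add: occurrences_def)
  have "(\<Sum>i<n. digit_weight (p i) (q i) (r i) (s i)) =
     - int (occurrences n {2, 3} p)
     - (3 * int (occurrences n {0, 5} q) + 2 * int (occurrences n {1, 4} q)
        + 2 * int (occurrences n {2, 3} q))
     - (2 * int (occurrences n {0, 5} r) + int (occurrences n {1, 4} r))
     + (5 * int (occurrences n {0, 5} s) + 3 * int (occurrences n {1, 4} s)
        + 3 * int (occurrences n {2, 3} s))"
    by (simp only: digit_weight_def sum.distrib sum_subtractf sum_negf
          sum_distrib_left[symmetric] occ)
  \<comment> \<open>With common counts a, b, c the total is (5-3-2)a + (3-2-1)b + (3-1-2)c.\<close>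
  also have "\<dots> = 0"
    using assms by (auto simp: word_type_def)
  finally show ?thesis .
qed

lemma no_proper_AP_word_type:
  assumes S: "S \<subseteq> ({..<n} \<rightarrow>\<^sub>E digits)" and type: "\<And>w. w \<in> S \<Longrightarrow> word_type n w = t"
  shows "\<not> has_proper_AP (Zmod_pow 11 n) 4 S"
proof
  assume "has_proper_AP (Zmod_pow 11 n) 4 S"
  then obtain x d where x: "x \<in> {..<n} \<rightarrow>\<^sub>E {0..<11}" and d: "d \<in> {..<n} \<rightarrow>\<^sub>E {0..<11}"
    and inj: "inj_on (arith_prog (Zmod_pow 11 n) x d) {..<4}"
    and sub: "arith_prog (Zmod_pow 11 n) x d ` {..<4} \<subseteq> S"
    by (auto simp: has_proper_AP_def carrier_Zmod_pow)
  define P where "P = arith_prog (Zmod_pow 11 n) x d"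
  have P: "P j i = (x i + int j * d i) mod 11" if "i < n" for i j
    using that by (simp add: P_def arith_prog_Zmod_pow)
  have PS: "P j \<in> S" if "j < 4" for j
    using that sub by (auto simp: P_def)
  have digit: "P j i \<in> digits" if "i < n" "j < 4" for i j
    using PS[OF that(2)] S that(1) by (auto simp: PiE_iff)
  let ?f = "\<lambda>i. digit_weight (P 0 i) (P 1 i) (P 2 i) (P 3 i)"
  have pos: "?f i > 0" if "i < n" "d i \<noteq> 0" for i
    using digit_weight_pos[of "x i" "d i"] x d that digit[OF that(1)]
    by (simp add: P PiE_iff)
  \<comment> \<open>Where \<open>d i\<close> vanishes the four digits coincide and their weights
    cancel.\<close>
  have nonneg: "?f i \<ge> 0" if "i < n" for i
    using pos[OF that] that by (cases "d i = 0") (auto simp: P digit_weight_const)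
  \<comment> \<open>All four terms lie in \<open>S\<close> and so share the type \<open>t\<close>. A
    zero sum of nonnegative weights forces each weight to vanish, which by \<open>pos\<close>
    excludes a nonzero \<open>d i\<close>.\<close>
  have "(\<Sum>i<n. ?f i) = 0"
    by (rule sum_digit_weight_eq_0[of n _ t]) (simp_all add: type PS)
  then have "?f i = 0" if "i < n" for i
    using that nonneg by (subst (asm) sum_nonneg_eq_0_iff) auto
  then have d0: "d i = 0" if "i < n" for i
    using pos[of i] that by fastforce
  \<comment> \<open>A difference that is zero in every coordinate makes the terms coincide, against
    properness.\<close>
  have "P 0 = P 1"
  proof (rule PiE_ext)
    show "P 0 \<in> {..<n} \<rightarrow>\<^sub>E digits" "P 1 \<in> {..<n} \<rightarrow>\<^sub>E digits"
      using PS[of 0] PS[of 1] S by auto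
  qed (simp add: P d0)
  then show False
    using inj_onD[OF inj, of 0 1] by (simp add: P_def)
qed

lemma r_AP_4_Zmod_11_ge: "7 ^ n \<le> r_AP 4 (Zmod_pow 11 n) * (n + 1) ^ 3"
proof -
  let ?W = "{..<n} \<rightarrow>\<^sub>E digits" and ?T = "{..n} \<times> {..n} \<times> {..n}"
  have "occurrences n A w \<le> n" for A w
    unfolding occurrences_def by (rule order.trans[OF card_mono[of "{..<n}"]]) auto
  then have "word_type n \<in> ?W \<rightarrow> ?T"
    by (auto simp: word_type_def)
  moreover have "finite ?W"
    by (auto simp: digits_def intro: finite_PiE)
  \<comment> \<open>Pigeonhole: the most popular type has a fibre of size at least
    \<open>card ?W / card ?T\<close>.\<close>
  ultimately obtain t where t: "card ?W \<le> card (word_type n -` {t} \<inter> ?W) * card ?T"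
    using pigeonhole_card[of "word_type n" ?W ?T] by auto
  have "card ?W = 7 ^ n"
    by (simp add: card_PiE digits_def numeral_eq_Suc)
  moreover have "card ?T = (n + 1) ^ 3"
    by (simp add: card_cartesian_product power3_eq_cube)
  moreover have "card (word_type n -` {t} \<inter> ?W) \<le> r_AP 4 (Zmod_pow 11 n)"
  proof (rule card_le_r_AP)
    show "finite (carrier (Zmod_pow 11 n))"
      by (auto simp: carrier_Zmod_pow intro: finite_PiE)
    have "?W \<subseteq> ({..<n} \<rightarrow>\<^sub>E {0..<11})"
      by (rule PiE_mono) (auto simp: digits_def)
    then show "word_type n -` {t} \<inter> ?W \<subseteq> carrier (Zmod_pow 11 n)"
      by (auto simp: carrier_Zmod_pow)
    show "\<not> has_proper_AP (Zmod_pow 11 n) 4 (word_type n -` {t} \<inter> ?W)"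
      by (rule no_proper_AP_word_type) auto
  qed
  ultimately show ?thesis
    using t by (metis mult_le_mono1 order.trans)
qed

theorem theorem3p12:
  shows "\<exists>c::real. c > 0 \<and>
    (\<forall>n::nat. n \<ge> 1 \<longrightarrow> real (r_AP 4 (Zmod_pow 11 n)) \<ge> c * (7 ^ n / real n ^ 3))"
proof (intro exI[of _ "1/8"] conjI allI impI)
  fix n :: nat assume n: "n \<ge> 1"
  let ?r = "r_AP 4 (Zmod_pow 11 n)"
  have "7 ^ n \<le> ?r * (n + 1) ^ 3"
    by (rule r_AP_4_Zmod_11_ge)
  \<comment> \<open>The constant 1/8 arises here: n + 1 \<le> 2n for n \<ge> 1, and cubing costs a
    factor 8.\<close>
  also have "\<dots> \<le> ?r * (2 * n) ^ 3"
    using n by (intro mult_le_mono2 power_mono) auto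
  finally have "real (7 ^ n) \<le> real (?r * (2 * n) ^ 3)"
    by (simp only: of_nat_le_iff)
  then show "real ?r \<ge> 1/8 * (7 ^ n / real n ^ 3)"
    using n by (simp add: field_simps)
qed simp

end
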